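(* Let $S$ be a nontrivial ($S \neq \{0\}$) pseudosymmetric numerical semigroup with Frobenius number $g(S)$ and multiplicity $m(S)$. (a) If $g(S) < m(S)$, then $\dim_{\mathrm{mat}} S = 2$. (b) If $m(S) < g(S) < 2m(S)$, then $\dim_{\mathrm{mat}} S \geq m(S) - 1$. (c) If $g(S) \geq 2m(S)$, then $\dim_{\mathrm{mat}} S \geq m(S)$.
   Context: $\mathbb{N} = \{0,1,2,\ldots\}$. A numerical semigroup is an additive subsemigroup of $\mathbb{N}$ containing $0$ whose complement in $\mathbb{N}$ is finite. Its Frobenius number $g(S)$ is the largest natural number not in $S$ (with the usual convention $g(\mathbb{N}) = -1$, so that $\mathbb{N}$ is not pseudosymmetric). $S$ is pseudosymmetric if $g(S)$ is even and, for every $x \in \mathbb{Z}\setminus S$, either $g(S) - x \in S$ or $x = g(S)/2$. The multiplicity $m(S)$ is the least element of the unique minimal generating set of $S$, i.e. the least positive element of $S$. For $A \in \mathrm{M}_d(\mathbb{Q})$ ($d \times d$ rational matrices), the exponent semigroup is $\mathcal{S}(A) = \{ n \in \mathbb{N} : A^n \in \mathrm{M}_d(\mathbb{Z})\}$, where $A^0=I$. The matricial dimension is $\dim_{\mathrm{mat}} S = \min\{ d \geq 1 : \text{there is an } A \in \mathrm{M}_d(\mathbb{Q}) \text{ such that } S = \mathcal{S}(A)\}$ (such $d$ exists for every additive subsemigroup of $\mathbb{N}$ containing $0$). *)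

theory Defs
  imports "Jordan_Normal_Form.Matrix"
begin

definition numerical_semigroup :: "nat set \<Rightarrow> bool" where
  "numerical_semigroup S \<longleftrightarrow>
     0 \<in> S \<and> (\<forall>x\<in>S. \<forall>y\<in>S. x + y \<in> S) \<and> finite (- S)"

text \<open>The values are integers because of the convention that \<open>\<nat>\<close> has Frobenius number \<open>-1\<close>.\<close>

definition frobenius :: "nat set \<Rightarrow> int" where
  "frobenius S = (if S = UNIV then - 1 else int (Max (- S)))"

text \<open>The element \<open>x\<close> ranges over all integers outside \<open>S\<close>, including the negative ones;
  \<open>2 * x = frobenius S\<close> avoids the truncating division.\<close>

definition pseudosymmetric :: "nat set \<Rightarrow> bool" where
  "pseudosymmetric S \<longleftrightarrow>
     numerical_semigroup S \<and> even (frobenius S) \<and>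
     (\<forall>x. x \<notin> int ` S \<longrightarrow> frobenius S - x \<in> int ` S \<or> 2 * x = frobenius S)"

definition multiplicity_sg :: "nat set \<Rightarrow> nat" where
  "multiplicity_sg S = (LEAST n. n \<in> S \<and> 0 < n)"

text \<open>Intended for square \<open>A\<close>.  The power \<open>A ^\<^sub>m 0\<close> is the identity matrix.\<close>

definition exponent_semigroup :: "rat mat \<Rightarrow> nat set" where
  "exponent_semigroup A = {n. elements_mat (A ^\<^sub>m n) \<subseteq> \<int>}"

text \<open>For an additive subsemigroup of \<open>\<nat>\<close> containing \<open>0\<close> such a \<open>d\<close> always exists, so
  the \<open>LEAST\<close> is a genuine minimum there; for other sets the value is unspecified.\<close>

definition matricial_dim :: "nat set \<Rightarrow> nat" where
  "matricial_dim S =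
     (LEAST d. 1 \<le> d \<and> (\<exists>A \<in> carrier_mat d d. S = exponent_semigroup A))"

end

theory Submission
  imports Defs "Jordan_Normal_Form.Char_Poly" "Berlekamp_Zassenhaus.Factor_Bound"
begin

hide_const (open) up_ring.coeff up_ring.monom

text \<open>
  The lower bounds come from one fact about a rational \<open>d \<times> d\<close> matrix \<open>A\<close> that has some integral
  positive power: if \<open>d\<close> consecutive powers of \<open>A\<close> are integral, then so is the next one
  (\<open>exponent_semigroup_run\<close>).  The integral power \<open>A ^ c\<close> is a root of its characteristic
  polynomial, which makes \<open>A\<close> a root of a monic integral polynomial; by Gauss's lemma, the common
  divisor of that polynomial and \<open>char_poly A\<close> is integral as well, and it has degree at most \<open>d\<close>.
  So each power from the \<open>d\<close>-th on is an integral combination of the \<open>d\<close> powers before it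
  (\<open>cayley_hamilton_trajectory\<close>, \<open>integral_recurrence_extends_run\<close>).  Applied to \<open>S\<close>, this says
  that \<open>S\<close> has no \<open>d\<close> consecutive elements just below its Frobenius number \<open>g\<close> when \<open>S\<close> has
  matricial dimension \<open>d\<close>.

  Pseudosymmetry provides long runs there.  The numbers \<open>1, \<dots>, m - 1\<close> below the multiplicity \<open>m\<close> are
  gaps, so their reflections \<open>g - 1, \<dots>, g - (m - 1)\<close> lie in \<open>S\<close>, except possibly \<open>g / 2\<close>.  If
  \<open>g \<ge> 2 * m\<close>, then \<open>g / 2\<close> is not among them and the run has length \<open>m - 1\<close>.  If \<open>m < g < 2 * m\<close>,
  then \<open>g = 2 * m - 2\<close>: otherwise \<open>g - (m - 1)\<close> would be a positive element of \<open>S\<close>, hence at least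
  \<open>m\<close>, which leaves only the odd value \<open>2 * m - 1\<close> for \<open>g\<close>.  So the exception is the last reflection
  and the run has length \<open>m - 2\<close>.  Finally \<open>g < m\<close> forces \<open>S = {0, 3, 4, \<dots>}\<close>, which is the exponent
  semigroup of an explicit \<open>2 \<times> 2\<close> matrix; dimension \<open>1\<close> is excluded by the run \<open>{0}\<close> and the gap \<open>1\<close>.

  The bounds speak of a minimum, so they need some matrix that realizes \<open>S\<close>; a nilpotent weighted
  shift does (\<open>numerical_semigroup_is_exponent_semigroup\<close>).
\<close>

section \<open>Linear recurrences\<close>

text \<open>
  The polynomial ring acts on sequences, with the indeterminate acting as the shift;
  \<open>recurrence p s\<close> is the image of \<open>s\<close> under \<open>p\<close>.  Working with the scalar sequences of matrix entries
  replaces the evaluation of polynomials at matrices.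
\<close>

definition recurrence :: "'a :: comm_ring_1 poly \<Rightarrow> (nat \<Rightarrow> 'a) \<Rightarrow> nat \<Rightarrow> 'a" where
  "recurrence p s n = (\<Sum>k\<le>degree p. coeff p k * s (n + k))"

lemma recurrence_extend:
  assumes "degree p \<le> K"
  shows "recurrence p s n = (\<Sum>k\<le>K. coeff p k * s (n + k))"
  unfolding recurrence_def using assms
  by (intro sum.mono_neutral_left) (auto simp: coeff_eq_0)

lemma recurrence_0 [simp]: "recurrence 0 s n = 0"
  by (simp add: recurrence_def)

lemma recurrence_pCons [simp]: "recurrence (pCons a p) s n = a * s n + recurrence p s (Suc n)"
  using recurrence_extend[of "pCons a p" "Suc (degree p)" s n]
  by (simp add: recurrence_def sum.atMost_Suc_shift degree_pCons_le del: sum.atMost_Suc)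

lemma recurrence_add: "recurrence (p + q) s n = recurrence p s n + recurrence q s n"
proof -
  let ?K = "max (degree p) (degree q)"
  show ?thesis
    using recurrence_extend[of "p + q" ?K s n] recurrence_extend[of p ?K s n]
      recurrence_extend[of q ?K s n]
    by (simp add: degree_add_le sum.distrib algebra_simps)
qed

lemma recurrence_smult: "recurrence (smult a p) s n = a * recurrence p s n"
  by (induction p arbitrary: n) (simp_all add: algebra_simps)

lemma recurrence_mult_eq_0:
  assumes "\<And>n. recurrence p s n = 0"
  shows "recurrence (q * p) s n = 0"
  by (induction q arbitrary: n) (simp_all add: assms recurrence_add recurrence_smult)

lemma recurrence_monom_mult: "recurrence (monom 1 c * p) s n = recurrence p s (n + c)"
  by (induction c arbitrary: n)
    (simp_all add: monom_Suc monom_0 flip: one_pCons)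

lemma recurrence_pcompose_monom:
  "recurrence (pcompose p (monom 1 c)) s n = recurrence p (\<lambda>k. s (n + c * k)) 0"
proof (induction p arbitrary: n)
  case (pCons a p)
  have "recurrence p (\<lambda>k. s (n + c + c * k)) 0 = recurrence p (\<lambda>k. s (n + c * k)) (Suc 0)"
    by (simp add: recurrence_def algebra_simps)
  then show ?case
    by (simp add: pcompose_pCons recurrence_add recurrence_monom_mult pCons.IH)
qed simp

section \<open>Integral equations for matrix powers\<close>

text \<open>
  The Cayley--Hamilton theorem, applied to the orbit of a row vector under \<open>A\<close> (row \<open>f k\<close> at time
  \<open>k\<close>).  Compare coefficients in \<open>(X - A) * B = char_poly A\<close>, where \<open>B\<close> is the adjugate of \<open>X - A\<close>
  and \<open>B\<^sub>k\<close>, \<open>c\<^sub>k\<close> are the coefficients of \<open>B\<close> and \<open>char_poly A\<close>: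
  \<open>B\<^sub>k\<^sub>-\<^sub>1 - A * B\<^sub>k = c\<^sub>k\<close>.  Multiplied by the row \<open>f (n + k)\<close>, the left side telescopes.
  The form with an orbit covers both the entries of all powers of \<open>A\<close> and the entries of the powers
  whose exponents form an arithmetic progression.
\<close>

lemma cayley_hamilton_trajectory:
  fixes A :: "'a :: comm_ring_1 mat"
  assumes A: "A \<in> carrier_mat d d"
    and step: "\<And>k m. m < d \<Longrightarrow> f (Suc k) m = (\<Sum>l<d. f k l * A $$ (l, m))"
    and j: "j < d"
  shows "recurrence (char_poly A) (\<lambda>k. f k j) n = 0"
proof -
  define B where "B = adj_mat (char_poly_matrix A)"
  define b where "b k l = coeff (B $$ (l, j)) k" for k l
  define T where "T k = (if k = 0 then 0 else \<Sum>l<d. f (n + k) l * b (k - 1) l)" for k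
  have M: "char_poly_matrix A \<in> carrier_mat d d" using A by simp
  have B: "B \<in> carrier_mat d d"
    and MB: "char_poly_matrix A * B = char_poly A \<cdot>\<^sub>m 1\<^sub>m d"
    using adj_mat[OF M] by (auto simp: B_def char_poly_def)
  have entry: "(if l = j then char_poly A else 0) =
      pCons 0 (B $$ (l, j)) - (\<Sum>m<d. smult (A $$ (l, m)) (B $$ (m, j)))" if l: "l < d" for l
  proof -
    have "(if l = j then char_poly A else 0) = (char_poly_matrix A * B) $$ (l, j)"
      using l j by (simp add: MB)
    also have "\<dots> = (\<Sum>m<d. char_poly_matrix A $$ (l, m) * B $$ (m, j))"
      using M B l j by (simp add: scalar_prod_def lessThan_atLeast0)
    also have "\<dots> = (\<Sum>m<d. (if m = l then pCons 0 (B $$ (l, j)) else 0)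
                        - smult (A $$ (l, m)) (B $$ (m, j)))"
      using A l by (intro sum.cong) (auto simp: char_poly_matrix_def)
    also have "\<dots> = pCons 0 (B $$ (l, j)) - (\<Sum>m<d. smult (A $$ (l, m)) (B $$ (m, j)))"
      using l by (simp add: sum_subtractf)
    finally show ?thesis .
  qed
  have coeffs: "(if l = j then coeff (char_poly A) k else 0) =
      (if k = 0 then 0 else b (k - 1) l) - (\<Sum>m<d. A $$ (l, m) * b k m)" if l: "l < d" for k l
    using arg_cong[OF entry[OF l], of "\<lambda>p. coeff p k"]
    by (cases k) (auto simp: b_def coeff_sum split: if_splits)
  have tele: "coeff (char_poly A) k * f (n + k) j = T k - T (Suc k)" for k
  proof -
    have "coeff (char_poly A) k * f (n + k) j
        = (\<Sum>l<d. f (n + k) l * (if l = j then coeff (char_poly A) k else 0))"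
      using j by (simp add: if_distrib[of "\<lambda>x. _ * x"] mult.commute cong: if_cong)
    also have "\<dots> = (\<Sum>l<d. f (n + k) l * ((if k = 0 then 0 else b (k - 1) l)
                        - (\<Sum>m<d. A $$ (l, m) * b k m)))"
      by (intro sum.cong refl) (simp only: coeffs lessThan_iff)
    also have "\<dots> = T k - (\<Sum>l<d. f (n + k) l * (\<Sum>m<d. A $$ (l, m) * b k m))"
      by (simp add: right_diff_distrib sum_subtractf T_def)
    also have "(\<Sum>l<d. f (n + k) l * (\<Sum>m<d. A $$ (l, m) * b k m))
        = (\<Sum>m<d. (\<Sum>l<d. f (n + k) l * A $$ (l, m)) * b k m)"
      by (simp add: sum_distrib_left sum_distrib_right mult.assoc) (rule sum.swap)
    also have "\<dots> = T (Suc k)"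
      unfolding T_def using step by simp
    finally show ?thesis .
  qed
  \<comment> \<open>beyond the degrees of all entries of column \<open>j\<close> of \<open>B\<close>, so that the telescoped sum ends in \<open>0\<close>\<close>
  define K where "K = degree (char_poly A) + (\<Sum>l<d. degree (B $$ (l, j)))"
  have "b (Suc K) l = 0" if "l < d" for l
  proof -
    have "degree (B $$ (l, j)) \<le> (\<Sum>l<d. degree (B $$ (l, j)))"
      using that by (intro member_le_sum) auto
    then show ?thesis unfolding b_def K_def by (intro coeff_eq_0) simp
  qed
  then have T_end: "T (Suc (Suc K)) = 0" by (simp add: T_def)
  have "recurrence (char_poly A) (\<lambda>k. f k j) n = (\<Sum>k\<le>Suc K. T k - T (Suc k))"
    by (subst recurrence_extend[of _ "Suc K"]) (simp_all add: K_def tele del: sum.atMost_Suc)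
  also have "\<dots> = T 0 - T (Suc (Suc K))"
    by (rule sum_telescope)
  finally show ?thesis using T_end by (simp add: T_def)
qed

text \<open>
  The polynomials that annihilate \<open>s\<close> form an ideal, so \<open>gcd p q\<close> annihilates \<open>s\<close> too.  It has degree at
  most \<open>d\<close> because it divides \<open>p\<close>, and it is integral with leading coefficient \<open>\<plusminus>1\<close> up to a scalar by
  Gauss's lemma because it divides the monic integral \<open>q\<close>.  Such a recurrence computes each term
  integrally from the \<open>d\<close> terms before it.
\<close>

lemma integral_recurrence_extends_run:
  fixes s :: "nat \<Rightarrow> rat" and p :: "rat poly" and q :: "int poly"
  assumes p: "\<And>n. recurrence p s n = 0" "p \<noteq> 0" "degree p \<le> d"
    and q: "\<And>n. recurrence (map_poly of_int q) s n = 0" "lead_coeff q = 1"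
    and run: "\<And>k. k < d \<Longrightarrow> s (n + k) \<in> \<int>"
  shows "s (n + d) \<in> \<int>"
proof -
  let ?q = "map_poly rat_of_int q"
  define g where "g = gcd p ?q"
  obtain u v where uv: "u * p + v * ?q = g"
    unfolding g_def by (metis bezout_coefficients_fst_snd)
  have g: "recurrence g s n = 0" for n
    unfolding uv[symmetric] recurrence_add
    using recurrence_mult_eq_0[OF p(1)] recurrence_mult_eq_0[OF q(1)] by simp
  have g0: "g \<noteq> 0" using p(2) by (simp add: g_def)
  have "degree g \<le> d" using dvd_imp_degree_le[of g p] p(2,3) by (simp add: g_def)
  obtain h where h: "?q = g * h" unfolding g_def by (metis gcd_dvd2 dvdE)
  obtain r g' where rg': "rat_to_normalized_int_poly g = (r, g')" by force
  note g' = rat_to_normalized_int_poly[OF rg']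
  from rat_to_int_factor_explicit[OF h rg'] obtain t where "q = g' * t" by blast
  with q(2) have "lead_coeff g' * lead_coeff t = 1" by (simp add: lead_coeff_mult)
  then have lead: "lead_coeff g' = 1 \<or> lead_coeff g' = -1"
    using zmult_eq_1_iff by blast
  have "recurrence (map_poly of_int g') s m = 0" for m
    using g[of m] g0 g'(1,2) by (metis recurrence_smult mult_eq_0_iff order_less_irrefl)
  from this[of "n + d - degree g"]
  have "(\<Sum>k\<le>degree g. of_int (coeff g' k) * s (n + d - degree g + k)) = 0"
    by (simp add: recurrence_def g'(4))
  also have "{..degree g} = insert (degree g) {..<degree g}" by auto
  finally have "of_int (lead_coeff g') * s (n + d) =
      - (\<Sum>k<degree g. of_int (coeff g' k) * s (n + d - degree g + k))"
    using \<open>degree g \<le> d\<close> by (simp add: g'(4) add_eq_0_iff)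
  also have "\<dots> \<in> \<int>"
  proof (intro Ints_minus Ints_sum Ints_mult Ints_of_int)
    fix k assume "k \<in> {..<degree g}"
    with \<open>degree g \<le> d\<close> have "n + d - degree g + k = n + (d - degree g + k)" "d - degree g + k < d"
      by auto
    then show "s (n + d - degree g + k) \<in> \<int>" using run by metis
  qed
  finally show ?thesis using lead by (auto simp: minus_in_Ints_iff)
qed

section \<open>Runs in exponent semigroups\<close>

lemma mem_exponent_semigroup_iff:
  assumes "A \<in> carrier_mat d d"
  shows "n \<in> exponent_semigroup A \<longleftrightarrow> (\<forall>i<d. \<forall>j<d. (A ^\<^sub>m n) $$ (i, j) \<in> \<int>)"
  using assms pow_carrier_mat[OF assms, of n]
  by (auto simp: exponent_semigroup_def elements_mat_def UN_subset_iff image_subset_iff)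

text \<open>
  The entries of the powers of \<open>A\<close> are annihilated by the rational polynomial \<open>char_poly A\<close> of degree
  \<open>d\<close>.  With \<open>N = A ^ c\<close> integral, they are also annihilated by the polynomial
  \<open>char_poly N\<close> evaluated at \<open>X ^ c\<close>, which is monic and integral but may have a larger degree.
\<close>

lemma exponent_semigroup_run:
  assumes A: "A \<in> carrier_mat d d"
    and c: "c \<in> exponent_semigroup A" "0 < c"
    and run: "{n..<n + d} \<subseteq> exponent_semigroup A"
  shows "n + d \<in> exponent_semigroup A"
  unfolding mem_exponent_semigroup_iff[OF A]
proof (intro allI impI)
  fix i j assume i: "i < d" and j: "j < d"
  have pow: "A ^\<^sub>m k \<in> carrier_mat d d" for k using A by simp
  have pow_add: "A ^\<^sub>m (k + l) = A ^\<^sub>m k * A ^\<^sub>m l" for k l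
    by (induction l) (use A pow in \<open>simp_all add: assoc_mult_mat[OF pow pow A] left_mult_one_mat\<close>)
  have step: "(A ^\<^sub>m (k + l)) $$ (i, m) = (\<Sum>t<d. (A ^\<^sub>m k) $$ (i, t) * (A ^\<^sub>m l) $$ (t, m))"
    if "m < d" for k l m
    using that i carrier_matD[OF pow[of k]] carrier_matD[OF pow[of l]]
    by (simp add: pow_add scalar_prod_def lessThan_atLeast0)
  define N where "N = map_mat floor (A ^\<^sub>m c)"
  have N: "N \<in> carrier_mat d d" using pow by (simp add: N_def)
  have "rat_of_int \<lfloor>(A ^\<^sub>m c) $$ (a, b)\<rfloor> = (A ^\<^sub>m c) $$ (a, b)" if "a < d" "b < d" for a b
    using c(1) that unfolding mem_exponent_semigroup_iff[OF A] by (metis Ints_cases floor_of_int)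
  then have AN: "map_mat of_int N = A ^\<^sub>m c"
    by (intro eq_matI) (simp_all add: N_def carrier_matD[OF A] split: if_splits)
  define q where "q = pcompose (char_poly N) (monom 1 c)"
  let ?s = "\<lambda>k. (A ^\<^sub>m k) $$ (i, j)"
  show "(A ^\<^sub>m (n + d)) $$ (i, j) \<in> \<int>"
  proof (rule integral_recurrence_extends_run[where s = ?s and p = "char_poly A" and q = q])
    show "recurrence (char_poly A) ?s m = 0" for m
      by (rule cayley_hamilton_trajectory[OF A _ j]) (use step[of _ _ 1] A in simp)
    show "char_poly A \<noteq> 0" "degree (char_poly A) \<le> d"
      using degree_monic_char_poly[OF A] by auto
    have "map_poly of_int q = pcompose (char_poly (A ^\<^sub>m c)) (monom 1 c)"
      unfolding q_def AN[symmetric] of_int_hom.char_poly_hom[OF N]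
      by (simp add: of_int_hom.map_poly_pcompose map_poly_monom)
    moreover have "recurrence (char_poly (A ^\<^sub>m c)) (\<lambda>k. (A ^\<^sub>m (m + c * k)) $$ (i, j)) 0 = 0" for m
    proof (rule cayley_hamilton_trajectory[OF pow _ j, where f = "\<lambda>k l. (A ^\<^sub>m (m + c * k)) $$ (i, l)"])
      fix k l assume "l < d"
      have "m + c * Suc k = m + c * k + c" by simp
      then show "(A ^\<^sub>m (m + c * Suc k)) $$ (i, l) =
          (\<Sum>t<d. (A ^\<^sub>m (m + c * k)) $$ (i, t) * (A ^\<^sub>m c) $$ (t, l))"
        using step[OF \<open>l < d\<close>] by metis
    qed
    ultimately show "recurrence (map_poly of_int q) ?s m = 0" for m
      by (simp add: recurrence_pcompose_monom)
    show "lead_coeff q = 1"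
      using c(2) degree_monic_char_poly[OF N] unfolding q_def
      by (subst lead_coeff_comp) (simp_all add: degree_monom_eq)
    show "(A ^\<^sub>m (n + k)) $$ (i, j) \<in> \<int>" if "k < d" for k
    proof -
      have "n + k \<in> exponent_semigroup A" using run that by auto
      then show ?thesis using i j by (simp add: mem_exponent_semigroup_iff[OF A])
    qed
  qed
qed

section \<open>Realizing semigroups by matrices\<close>

text \<open>
  The weighted shift \<open>A\<close> with superdiagonal entries \<open>w (i + 1) / w i\<close> has powers with entries
  \<open>w (i + n) / w i\<close>.  For \<open>w = 2\<close> on \<open>S\<close> and \<open>w = 1\<close> off \<open>S\<close>, such a quotient fails to be integral exactly
  when \<open>i \<in> S\<close> and \<open>i + n \<notin> S\<close>.  Closure under addition excludes this for \<open>n \<in> S\<close>, and for \<open>n \<notin> S\<close> it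
  happens at \<open>i = 0\<close>; the size of \<open>A\<close> exceeds all gaps, so that this entry exists.
\<close>

lemma numerical_semigroup_is_exponent_semigroup:
  assumes "numerical_semigroup S"
  shows "\<exists>d\<ge>1. \<exists>A\<in>carrier_mat d d. S = exponent_semigroup A"
proof -
  from assms have S0: "0 \<in> S" and Sadd: "\<And>x y. x \<in> S \<Longrightarrow> y \<in> S \<Longrightarrow> x + y \<in> S"
    and "finite (- S)" by (auto simp: numerical_semigroup_def)
  then obtain d where d: "\<And>n. n \<notin> S \<Longrightarrow> n < d"
    by (metis Compl_iff finite_nat_set_iff_bounded)
  define w :: "nat \<Rightarrow> rat" where "w n = (if n \<in> S then 2 else 1)" for n
  define A where "A = mat (Suc d) (Suc d) (\<lambda>(i, j). if j = Suc i then w j / w i else 0)"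
  have A: "A \<in> carrier_mat (Suc d) (Suc d)" by (simp add: A_def)
  have w0: "w n \<noteq> 0" for n by (simp add: w_def)
  have pow: "(A ^\<^sub>m n) $$ (i, j) = (if j = i + n then w j / w i else 0)"
    if "i < Suc d" "j < Suc d" for n i j
    using that
  proof (induction n arbitrary: j)
    case 0
    then show ?case using A w0 by auto
  next
    case (Suc n)
    have "(A ^\<^sub>m Suc n) $$ (i, j) = (\<Sum>k<Suc d. (A ^\<^sub>m n) $$ (i, k) * A $$ (k, j))"
      using Suc.prems A pow_carrier_mat[OF A, of n]
      by (simp add: scalar_prod_def lessThan_atLeast0)
    also have "\<dots> = (\<Sum>k<Suc d. if k = i + n then (if j = Suc k then w j / w i else 0) else 0)"
      using Suc w0 by (intro sum.cong) (auto simp: A_def)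
    also have "\<dots> = (if j = i + Suc n then w j / w i else 0)"
      using Suc.prems by (simp add: sum.delta del: sum.lessThan_Suc)
    finally show ?case .
  qed
  have "n \<in> S \<longleftrightarrow> n \<in> exponent_semigroup A" for n
  proof
    assume n: "n \<in> S"
    have "(A ^\<^sub>m n) $$ (i, j) \<in> \<int>" if "i < Suc d" "j < Suc d" for i j
      unfolding pow[OF that] using Sadd[OF _ n, of i] by (auto simp: w_def)
    then show "n \<in> exponent_semigroup A" by (simp add: mem_exponent_semigroup_iff[OF A])
  next
    assume n: "n \<in> exponent_semigroup A"
    show "n \<in> S"
    proof (rule ccontr)
      assume nS: "n \<notin> S"
      from d[OF nS] have "n < Suc d" by simp
      with n have "(A ^\<^sub>m n) $$ (0, n) \<in> \<int>" by (simp add: mem_exponent_semigroup_iff[OF A])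
      with \<open>n < Suc d\<close> nS S0 have "1 / 2 \<in> (\<int> :: rat set)" by (simp add: pow w_def)
      then obtain z :: int where "1 / 2 = (of_int z :: rat)" by (elim Ints_cases)
      then have "(of_int (2 * z) :: rat) = of_int 1" by simp
      then have "2 * z = 1" by (simp only: of_int_eq_iff)
      then show False by presburger
    qed
  qed
  then show ?thesis using A by (intro exI[of _ "Suc d"]) auto
qed

text \<open>
  The matrix with rows \<open>(2, 1/4)\<close> and \<open>(0, 0)\<close> satisfies \<open>A\<^sup>2 = 2 * A\<close>, so its power \<open>A\<^sup>n\<close> has the entry
  \<open>2\<^sup>n / 8\<close> in the corner for \<open>n \<ge> 1\<close>.
\<close>

lemma exponent_semigroup_zero_and_ge_3:
  "\<exists>A\<in>carrier_mat 2 2. exponent_semigroup A = {0} \<union> {3..}"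
proof -
  define A :: "rat mat" where
    "A = mat 2 2 (\<lambda>(i, j). if i = 0 then (if j = 0 then 2 else 1 / 4) else 0)"
  have A: "A \<in> carrier_mat 2 2" by (simp add: A_def)
  have pow: "A ^\<^sub>m Suc n = 2 ^ n \<cdot>\<^sub>m A" for n
  proof (induction n)
    case 0
    then show ?case using A by auto
  next
    case (Suc n)
    have "A ^\<^sub>m Suc (Suc n) = (2 ^ n \<cdot>\<^sub>m A) * A" using Suc.IH by simp
    also have "\<dots> = 2 ^ Suc n \<cdot>\<^sub>m A"
      by (rule eq_matI)
        (auto simp: A_def scalar_prod_def less_2_cases_iff numeral_2_eq_2)
    finally show ?case .
  qed
  have "Suc n \<in> exponent_semigroup A \<longleftrightarrow> 2 \<le> n" for n
  proof -
    have "Suc n \<in> exponent_semigroup A \<longleftrightarrow> (2 ^ n / 4 :: rat) \<in> \<int>"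
      unfolding mem_exponent_semigroup_iff[OF A] pow
      by (auto simp: A_def less_2_cases_iff)
    also have "\<dots> \<longleftrightarrow> 2 \<le> n"
    proof
      assume "2 \<le> n"
      then have "(2 ^ n / 4 :: rat) = 2 ^ (n - 2)" by (simp add: power_diff)
      then show "(2 ^ n / 4 :: rat) \<in> \<int>" by simp
    next
      assume "(2 ^ n / 4 :: rat) \<in> \<int>"
      then obtain z where "(2 ^ n / 4 :: rat) = of_int z" by (elim Ints_cases)
      then have "(of_int (2 ^ n) :: rat) = of_int (4 * z)" by simp
      then have "2 ^ n = 4 * z" by (simp only: of_int_eq_iff)
      moreover have "(1 :: int) \<noteq> 4 * z" "(2 :: int) \<noteq> 4 * z" by presburger+
      ultimately have "n \<noteq> 0" "n \<noteq> 1" by (metis power_0, metis power_one_right)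
      then show "2 \<le> n" by simp
    qed
    finally show ?thesis .
  qed
  moreover have "0 \<in> exponent_semigroup A"
    using A by (simp add: mem_exponent_semigroup_iff[OF A])
  ultimately have "n \<in> exponent_semigroup A \<longleftrightarrow> n \<in> {0} \<union> {3..}" for n
    by (cases n) auto
  then show ?thesis using A by blast
qed

section \<open>Matricial dimension\<close>

lemma matricial_dim_attained:
  assumes "numerical_semigroup S"
  shows "1 \<le> matricial_dim S \<and>
    (\<exists>A\<in>carrier_mat (matricial_dim S) (matricial_dim S). S = exponent_semigroup A)"
  unfolding matricial_dim_def
  by (rule LeastI_ex) (use numerical_semigroup_is_exponent_semigroup[OF assms] in blast)

text \<open>
  If the minimal dimension \<open>d\<close> were at most \<open>r\<close>, the last \<open>d\<close> elements of the run would force \<open>g\<close> into \<open>S\<close>.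
\<close>

lemma run_less_matricial_dim:
  assumes S: "numerical_semigroup S"
    and c: "c \<in> S" "0 < c"
    and run: "\<And>x. 1 \<le> x \<Longrightarrow> x \<le> r \<Longrightarrow> g - x \<in> S"
    and g: "g \<notin> S" "r \<le> g"
  shows "r < matricial_dim S"
proof (rule ccontr)
  let ?d = "matricial_dim S"
  assume "\<not> r < ?d"
  obtain A where A: "A \<in> carrier_mat ?d ?d" and SA: "S = exponent_semigroup A"
    using matricial_dim_attained[OF S] by blast
  have "{g - ?d..<g - ?d + ?d} \<subseteq> S"
  proof
    fix y assume "y \<in> {g - ?d..<g - ?d + ?d}"
    then have "g - (g - y) = y" "1 \<le> g - y" "g - y \<le> r"
      using \<open>\<not> r < ?d\<close> g(2) by auto
    then show "y \<in> S" using run by metis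
  qed
  then have "g - ?d + ?d \<in> S"
    using exponent_semigroup_run[OF A, of c] c SA by auto
  then show False using g \<open>\<not> r < ?d\<close> by simp
qed

theorem theorem5p6:
  fixes S :: "nat set"
  assumes "numerical_semigroup S"
    and "S \<noteq> {0}"
    and "pseudosymmetric S"
  shows "(frobenius S < int (multiplicity_sg S) \<longrightarrow> matricial_dim S = 2) \<and>
         (int (multiplicity_sg S) < frobenius S \<and> frobenius S < 2 * int (multiplicity_sg S)
            \<longrightarrow> int (matricial_dim S) \<ge> int (multiplicity_sg S) - 1) \<and>
         (frobenius S \<ge> 2 * int (multiplicity_sg S) \<longrightarrow> matricial_dim S \<ge> multiplicity_sg S)"
proof -
  let ?m = "multiplicity_sg S"
  have S0: "0 \<in> S" and fin: "finite (- S)" using assms(1) by (auto simp: numerical_semigroup_def)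
  have "S \<noteq> UNIV" using assms(3) by (auto simp: pseudosymmetric_def frobenius_def)
  define g where "g = Max (- S)"
  have frob: "frobenius S = int g" using \<open>S \<noteq> UNIV\<close> by (simp add: frobenius_def g_def)
  have gS: "g \<notin> S" unfolding g_def using Max_in[OF fin] \<open>S \<noteq> UNIV\<close> by auto
  have above: "n \<in> S" if "g < n" for n
    using that Max_ge[OF fin, of n] unfolding g_def by fastforce
  have even: "even g" using assms(3) by (simp add: pseudosymmetric_def frob)
  have "0 < g" using gS S0 by (metis gr0I)
  with even have g2: "2 \<le> g" by presburger
  have m: "?m \<in> S" "0 < ?m"
    using LeastI[of "\<lambda>n. n \<in> S \<and> 0 < n" "Suc g"] above[of "Suc g"] by (auto simp: multiplicity_sg_def)
  have below: "n \<notin> S" if "0 < n" "n < ?m" for n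
    using that not_less_Least[of n "\<lambda>n. n \<in> S \<and> 0 < n"] by (auto simp: multiplicity_sg_def)
  have reflect: "g - x \<in> S" if "x \<notin> S" "x \<le> g" "2 * x \<noteq> g" for x
  proof -
    have "int x \<notin> int ` S" "2 * int x \<noteq> int g" using that(1,3) by auto
    then have "int g - int x \<in> int ` S" using assms(3) by (auto simp: pseudosymmetric_def frob)
    then show ?thesis using that(2) by (auto simp flip: of_nat_diff)
  qed
  have "matricial_dim S = 2" if "g < ?m"
  proof -
    have "g = 2"
    proof (rule ccontr)
      assume "g \<noteq> 2"
      then have "g - 1 \<in> S" using reflect[of 1] below[of 1] that g2 by auto
      moreover have "0 < g - 1" "g - 1 < ?m" using that g2 by auto
      ultimately show False using below by blast
    qed
    then have 3: "S = {0} \<union> {3..}"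
    proof -
      have "n \<in> S \<longleftrightarrow> n = 0 \<or> 3 \<le> n" for n
        using above[of n] below[of n] \<open>g = 2\<close> that S0 by (cases "n = 0"; cases "3 \<le> n") auto
      then show ?thesis by auto
    qed
    have "1 < matricial_dim S"
      by (rule run_less_matricial_dim[OF assms(1) m, of _ 1]) (use S0 3 in auto)
    moreover have "matricial_dim S \<le> 2"
      unfolding matricial_dim_def
      by (rule Least_le) (use exponent_semigroup_zero_and_ge_3 in \<open>auto simp: 3\<close>)
    ultimately show ?thesis by simp
  qed
  moreover have "?m - 1 \<le> matricial_dim S" if "?m < g" "g < 2 * ?m"
  proof -
    \<comment> \<open>the exceptional point of the reflection is \<open>m - 1\<close>, just outside the run used here\<close>
    have "2 * (?m - 1) = g"
    proof (rule ccontr)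
      assume ne: "2 * (?m - 1) \<noteq> g"
      have "g - (?m - 1) \<in> S" using reflect[of "?m - 1"] below[of "?m - 1"] ne that m(2) g2 by fastforce
      then have "?m \<le> g - (?m - 1)" using below[of "g - (?m - 1)"] that m(2) by fastforce
      then have "g = 2 * ?m - 1" using that by linarith
      then show False using even m(2) by presburger
    qed
    then have "g - x \<in> S" if "1 \<le> x" "x \<le> ?m - 2" for x
      using reflect[of x] below[of x] that by force
    then have "?m - 2 < matricial_dim S"
      using \<open>?m < g\<close> by (intro run_less_matricial_dim[OF assms(1) m _ gS]) auto
    then show ?thesis by simp
  qed
  moreover have "?m \<le> matricial_dim S" if "2 * ?m \<le> g"
  proof -
    have "g - x \<in> S" if "1 \<le> x" "x \<le> ?m - 1" for x
      using reflect[of x] below[of x] that \<open>2 * ?m \<le> g\<close> by force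
    then have "?m - 1 < matricial_dim S"
      using that m(2) by (intro run_less_matricial_dim[OF assms(1) m _ gS]) auto
    then show ?thesis by simp
  qed
  ultimately show ?thesis using m(2) by (auto simp: frob)
qed

end
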